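(* Let $\rho:\mathbb{R}^3\to\mathbb{R}_{\ge 0}$ be a probability density supported in the closed unit ball of $\mathbb{R}^3$, and let $I_1,I_2$ be its tomographic projections along unit vectors $\mathbf{u}$ and $\mathbf{v}$ respectively, with $\measuredangle(\mathbf{u},\mathbf{v})\in[0,\pi]$ the angle between them. Then $$W_1^R(I_1,I_2)\le 2\sin\big(\measuredangle(\mathbf{u},\mathbf{v})/2\big)\le\measuredangle(\mathbf{u},\mathbf{v}).$$
   Context: For $R\in\mathrm{SO}(3)$ define $(R\rho)(\mathbf{x})=\rho(R^T\mathbf{x})$. The tomographic projection of $\rho$ along a unit vector $\mathbf{u}$ is the function on $\mathbb{R}^2$ given by $I(x,y)=\int_{\mathbb{R}}(R\rho)(x,y,z)\,dz$, where $R\in\mathrm{SO}(3)$ is any rotation with $R\mathbf{u}=(0,0,-1)$; different choices of $R$ change $I$ only by an in-plane rotation. Such a projection is a probability density on $\mathbb{R}^2$. For probability measures $\mu,\nu$ on $\mathbb{R}^2$, $W_1(\mu,\nu)=\inf_{\pi\in\Pi(\mu,\nu)}\int\|a-b\|\,d\pi(a,b)$, with $\Pi(\mu,\nu)$ the set of couplings. For $g\in\mathrm{SO}(2)$ let $(gI)(\mathbf{w})=I(g^T\mathbf{w})$, and define $W_1^R(I_1,I_2)=\min_{g\in\mathrm{SO}(2)}W_1(I_1,gI_2)$. *)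

theory Defs
  imports "HOL-Probability.Probability"
begin

text \<open>Angle between two nonzero vectors, in [0, pi].\<close>
definition vec_angle :: "real^3 \<Rightarrow> real^3 \<Rightarrow> real" where
  "vec_angle u v = arccos ((u \<bullet> v) / (norm u * norm v))"

text \<open>Tomographic projection of rho using rotation R (which should map the
  viewing direction to (0,0,-1)): I(x,y) = integral over z of (R rho)(x,y,z),
  where (R rho)(p) = rho(R^T p).\<close>
definition tomo_proj :: "real^3^3 \<Rightarrow> (real^3 \<Rightarrow> real) \<Rightarrow> real^2 \<Rightarrow> real" where
  "tomo_proj R rho w = (LINT z|lborel. rho (transpose R *v vector [w$1, w$2, z]))"

text \<open>Probability measure on R^2 with density I.\<close>
definition dens_measure :: "(real^2 \<Rightarrow> real) \<Rightarrow> (real^2) measure" where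
  "dens_measure I = density lborel (\<lambda>w. ennreal (I w))"

text \<open>Couplings of two measures on R^2.\<close>
definition couplings :: "(real^2) measure \<Rightarrow> (real^2) measure \<Rightarrow> (((real^2) \<times> (real^2)) measure) set" where
  "couplings \<mu> \<nu> = {\<pi>. prob_space \<pi> \<and> sets \<pi> = sets (borel :: ((real^2) \<times> (real^2)) measure)
      \<and> distr \<pi> borel fst = \<mu> \<and> distr \<pi> borel snd = \<nu>}"

text \<open>Wasserstein-1 distance (value in [0, infinity]).\<close>
definition W1 :: "(real^2) measure \<Rightarrow> (real^2) measure \<Rightarrow> ennreal" where
  "W1 \<mu> \<nu> = (INF \<pi>\<in>couplings \<mu> \<nu>. \<integral>\<^sup>+ p. ennreal (norm (fst p - snd p)) \<partial>\<pi>)"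

text \<open>In-plane rotation action: (g I)(w) = I(g^T w).\<close>
definition rot2 :: "real^2^2 \<Rightarrow> (real^2 \<Rightarrow> real) \<Rightarrow> real^2 \<Rightarrow> real" where
  "rot2 g I w = I (transpose g *v w)"

text \<open>Rotation-invariant W1 between two densities on R^2 (min over SO(2),
  rendered as infimum).\<close>
definition W1R :: "(real^2 \<Rightarrow> real) \<Rightarrow> (real^2 \<Rightarrow> real) \<Rightarrow> ennreal" where
  "W1R I1 I2 = (INF g\<in>{g. rotation_matrix g}. W1 (dens_measure I1) (dens_measure (rot2 g I2)))"

end

(*
  Let S be a rotation carrying u to v that moves every point x by at most |u - v| |x|: the
  rotation about the axis u \<times> v given by Rodrigues' formula, or a half-turn when v = -u.
  The rotation R = R1 S^T maps v to (0, 0, -1) just as R2 does, so the projection of rho taken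
  with R is an in-plane rotation g I2 of I2. Pushing rho forward under x \<mapsto> (P (R1 x), P (R x)),
  where P forgets the third coordinate, couples I1 with g I2. Since |R1 x - R x| = |S x - x|,
  which is at most |u - v| on the unit ball, this coupling costs at most |u - v| = 2 sin (\<theta>/2),
  and 2 sin (\<theta>/2) \<le> \<theta>.
*)

theory Submission
  imports Defs
begin

section \<open>Orthogonal matrices and Lebesgue measure\<close>

lemma orthogonal_matrix_mult_cancel:
  assumes "orthogonal_matrix A"
  shows "transpose A *v (A *v x) = x" and "A *v (transpose A *v x) = x"
  using assms unfolding matrix_vector_mul_assoc orthogonal_matrix_def by simp_all

lemma norm_orthogonal_matrix_mult:
  fixes A :: "real^'n^'n"
  assumes "orthogonal_matrix A"
  shows "norm (A *v x) = norm x"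
  using assms orthogonal_transformation_matrix orthogonal_transformation_norm
  by (metis matrix_of_matrix_vector_mul matrix_vector_mul_linear)

lemma rotation_matrix_mul:
  fixes A B :: "real^'n^'n"
  shows "rotation_matrix A \<Longrightarrow> rotation_matrix B \<Longrightarrow> rotation_matrix (A ** B)"
  by (simp add: rotation_matrix_def orthogonal_matrix_mul det_mul)

lemma rotation_matrix_transpose:
  fixes A :: "real^'n^'n"
  shows "rotation_matrix A \<Longrightarrow> rotation_matrix (transpose A)"
  by (simp add: rotation_matrix_def det_transpose)

lemma norm_orthogonal_matrix_diff_mult_transpose:
  fixes A S :: "real^'n^'n"
  assumes "orthogonal_matrix A" and "orthogonal_matrix S"
  shows "norm (A *v x - (A ** transpose S) *v x) = norm (S *v x - x)"
proof -
  have "A *v x - (A ** transpose S) *v x = A *v (x - transpose S *v x)"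
    by (simp add: matrix_vector_mult_diff_distrib flip: matrix_vector_mul_assoc
        del: transpose_matrix_vector)
  then have "norm (A *v x - (A ** transpose S) *v x) = norm (S *v (x - transpose S *v x))"
    by (simp only: norm_orthogonal_matrix_mult assms)
  also have "S *v (x - transpose S *v x) = S *v x - x"
    by (simp add: matrix_vector_mult_diff_distrib orthogonal_matrix_mult_cancel(2)[OF assms(2)]
        del: transpose_matrix_vector)
  finally show ?thesis .
qed

lemma borel_measurable_matrix_vector_mult [measurable]:
  "(\<lambda>x. (A::real^'n^'m) *v x) \<in> borel_measurable borel"
  by (intro borel_measurable_continuous_onI linear_continuous_on matrix_vector_mul_bounded_linear)

lemma distr_lborel_orthogonal_matrix:
  fixes A :: "real^('n::{finite,wellorder})^('n::_)"
  assumes A: "orthogonal_matrix A"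
  shows "distr lborel borel (\<lambda>x. A *v x) = lborel"
proof (rule lborel_eqI[symmetric])
  fix l u :: "real^('n::_)"
  assume le: "\<And>b. b \<in> Basis \<Longrightarrow> l \<bullet> b \<le> u \<bullet> b"
  let ?T = "\<lambda>x. transpose A *v x"
  have T: "orthogonal_transformation ?T"
    unfolding orthogonal_transformation_matrix matrix_of_matrix_vector_mul
    using A matrix_vector_mul_linear orthogonal_matrix_transpose by blast
  have box: "box l u \<in> lmeasurable"
    by simp
  have preimage: "(\<lambda>x. A *v x) -` box l u = ?T ` box l u"
    using orthogonal_matrix_mult_cancel[OF A] by (auto simp del: transpose_matrix_vector intro!: image_eqI)
  have "?T ` box l u \<in> sets borel"
    unfolding preimage[symmetric] using measurable_sets[OF borel_measurable_matrix_vector_mult, of "box l u" A]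
    by simp
  then have "emeasure (distr lborel borel (\<lambda>x. A *v x)) (box l u) = emeasure lebesgue (?T ` box l u)"
    by (simp add: emeasure_distr preimage)
  also have "\<dots> = measure lebesgue (?T ` box l u)"
    using measurable_orthogonal_image[OF T box] by (intro emeasure_eq_ennreal_measure fmeasurableD2)
  also have "\<dots> = measure lebesgue (box l u)"
    by (simp only: measure_orthogonal_image[OF T box])
  also have "\<dots> = emeasure lborel (box l u)"
    using box by (simp add: emeasure_eq_ennreal_measure[symmetric] fmeasurableD2)
  finally show "emeasure (distr lborel borel (\<lambda>x. A *v x)) (box l u) = (\<Prod>b\<in>Basis. (u - l) \<bullet> b)"
    using le by (simp add: emeasure_lborel_box_eq)
qed simp

section \<open>Projections and couplings\<close>

definition join_xyz :: "(real^2) \<times> real \<Rightarrow> real^3" where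
  "join_xyz p = vector [fst p $ 1, fst p $ 2, snd p]"

definition proj_xy :: "real^3 \<Rightarrow> real^2" where
  "proj_xy x = vector [x $ 1, x $ 2]"

lemma linear_join_xyz: "linear join_xyz"
  by (rule linearI) (simp_all add: join_xyz_def vec_eq_iff forall_3)

lemma linear_proj_xy: "linear proj_xy"
  by (rule linearI) (simp_all add: proj_xy_def vec_eq_iff forall_2)

lemma borel_measurable_join_xyz [measurable]: "join_xyz \<in> borel_measurable borel"
  by (intro borel_measurable_continuous_onI linear_continuous_on
      linear_join_xyz[THEN linear_conv_bounded_linear[THEN iffD1]])

lemma borel_measurable_proj_xy [measurable]: "proj_xy \<in> borel_measurable borel"
  by (intro borel_measurable_continuous_onI linear_continuous_on
      linear_proj_xy[THEN linear_conv_bounded_linear[THEN iffD1]])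

lemma proj_xy_join_xyz [simp]: "proj_xy (join_xyz p) = fst p"
  by (simp add: proj_xy_def join_xyz_def vec_eq_iff forall_2)

lemma norm_proj_xy_le: "norm (proj_xy x) \<le> norm x"
proof (rule power2_le_imp_le)
  show "(norm (proj_xy x))\<^sup>2 \<le> (norm x)\<^sup>2"
    by (simp add: power2_norm_eq_inner inner_vec_def sum_2 sum_3 proj_xy_def)
qed simp

lemma tomo_proj_eq_integral_join_xyz:
  "tomo_proj A rho w = (\<integral>z. rho (transpose A *v join_xyz (w, z)) \<partial>lborel)"
  by (simp add: tomo_proj_def join_xyz_def del: transpose_matrix_vector)

lemma prod_Basis_vec: "(\<Prod>b\<in>(Basis :: (real^'n) set). f b) = (\<Prod>i\<in>UNIV. f (axis i 1))"
proof -
  have Basis_eq: "(Basis :: (real^'n) set) = range (\<lambda>i. axis i 1)"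
    by (auto simp: Basis_vec_def)
  show ?thesis
    unfolding Basis_eq by (subst prod.reindex) (auto simp: inj_on_def axis_eq_axis)
qed

lemma emeasure_lborel_box_cart:
  fixes l u :: "real^'n"
  assumes "\<And>i. l $ i \<le> u $ i"
  shows "emeasure lborel (box l u) = ennreal (\<Prod>i\<in>UNIV. u $ i - l $ i)"
proof -
  have "\<forall>b\<in>Basis. l \<bullet> b \<le> u \<bullet> b"
    using assms by (auto simp: Basis_vec_def inner_axis)
  then show ?thesis
    by (simp add: emeasure_lborel_box_eq prod_Basis_vec inner_axis)
qed

lemma distr_lborel_join_xyz: "distr lborel borel join_xyz = lborel"
proof (rule lborel_eqI[symmetric])
  fix l u :: "real^3"
  assume box_le: "\<And>b. b \<in> Basis \<Longrightarrow> l \<bullet> b \<le> u \<bullet> b"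
  have le: "l $ i \<le> u $ i" for i
    using box_le[of "axis i 1"] by (auto simp: Basis_vec_def inner_axis)
  define L :: "real^2" where "L = vector [l$1, l$2]"
  define U :: "real^2" where "U = vector [u$1, u$2]"
  have LU: "L $ i \<le> U $ i" for i
    using le exhaust_2[of i] by (auto simp: L_def U_def)
  have box_LU: "emeasure lborel (box L U) = ennreal ((u$1 - l$1) * (u$2 - l$2))"
    unfolding emeasure_lborel_box_cart[OF LU] UNIV_2 by (simp add: L_def U_def)
  have preimage: "join_xyz -` box l u = box L U \<times> box (l$3) (u$3)"
    by (auto simp: join_xyz_def mem_box_cart forall_2 forall_3 L_def U_def)
  have "emeasure (distr lborel borel join_xyz) (box l u)
      = emeasure (lborel \<Otimes>\<^sub>M lborel) (box L U \<times> box (l$3) (u$3))"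
    by (simp add: emeasure_distr preimage lborel_prod)
  also have "\<dots> = emeasure lborel (box L U) * emeasure lborel (box (l$3) (u$3))"
    by (simp add: lborel.emeasure_pair_measure_Times)
  also have "\<dots> = ennreal ((u$1 - l$1) * (u$2 - l$2) * (u$3 - l$3))"
    using le[of 3] by (simp add: box_LU ennreal_mult'')
  also have "\<dots> = (\<Prod>b\<in>Basis. (u - l) \<bullet> b)"
    unfolding prod_Basis_vec UNIV_3 by (simp add: inner_axis mult.assoc)
  finally show "emeasure (distr lborel borel join_xyz) (box l u) = (\<Prod>b\<in>Basis. (u - l) \<bullet> b)" .
qed simp

lemma distr_fst_density_lborel:
  fixes g :: "('a::euclidean_space \<times> 'b::euclidean_space) \<Rightarrow> ennreal"
  assumes [measurable]: "g \<in> borel_measurable borel"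
  shows "distr (density lborel g) borel fst = density lborel (\<lambda>w. \<integral>\<^sup>+z. g (w, z) \<partial>lborel)"
proof (rule measure_eqI)
  fix B
  assume "B \<in> sets (distr (density lborel g) borel fst)"
  then have [measurable]: "B \<in> sets borel"
    by simp
  have [measurable]: "fst \<in> borel_measurable (borel :: ('a \<times> 'b) measure)"
    unfolding borel_prod[symmetric] by simp
  have "emeasure (distr (density lborel g) borel fst) B
      = emeasure (density (lborel \<Otimes>\<^sub>M lborel) g) (fst -` B)"
    by (simp add: emeasure_distr lborel_prod)
  also have "\<dots> = (\<integral>\<^sup>+p. g p * indicator (fst -` B) p \<partial>(lborel \<Otimes>\<^sub>M lborel))"
    by (rule emeasure_density) (auto simp: lborel_prod vimage_fst)
  also have "\<dots> = (\<integral>\<^sup>+w. \<integral>\<^sup>+z. g (w, z) * indicator B w \<partial>lborel \<partial>lborel)"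
    by (subst lborel.nn_integral_fst[symmetric]) (auto simp: indicator_def lborel_prod)
  also have "\<dots> = (\<integral>\<^sup>+w. (\<integral>\<^sup>+z. g (w, z) \<partial>lborel) * indicator B w \<partial>lborel)"
    by (simp add: nn_integral_multc)
  also have "\<dots> = emeasure (density lborel (\<lambda>w. \<integral>\<^sup>+z. g (w, z) \<partial>lborel)) B"
    by (rule emeasure_density[symmetric]) auto
  finally show "emeasure (distr (density lborel g) borel fst) B
      = emeasure (density lborel (\<lambda>w. \<integral>\<^sup>+z. g (w, z) \<partial>lborel)) B" .
qed simp

lemma distr_lborel_transpose_join_xyz:
  assumes "orthogonal_matrix A"
  shows "distr lborel borel (\<lambda>p. transpose A *v join_xyz p) = lborel"
proof -
  have "distr lborel borel (\<lambda>p. transpose A *v join_xyz p)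
      = distr (distr lborel borel join_xyz) borel (\<lambda>x. transpose A *v x)"
    by (simp add: distr_distr comp_def del: transpose_matrix_vector)
  also have "\<dots> = lborel"
    using assms distr_lborel_orthogonal_matrix[of "transpose A"]
    by (simp add: distr_lborel_join_xyz del: transpose_matrix_vector)
  finally show ?thesis .
qed

lemma distr_density_proj_xy:
  fixes A :: "real^3^3"
  assumes A: "orthogonal_matrix A" and [measurable]: "rho \<in> borel_measurable borel"
    and nonneg: "\<And>x. rho x \<ge> 0" and int: "integrable lborel rho"
  shows "distr (density lborel (\<lambda>x. ennreal (rho x))) borel (\<lambda>x. proj_xy (A *v x))
    = dens_measure (tomo_proj A rho)"
proof -
  define \<phi> where "\<phi> p = transpose A *v join_xyz p" for p
  have [measurable]: "\<phi> \<in> borel_measurable borel"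
    unfolding \<phi>_def[abs_def] by measurable
  have \<phi>: "distr lborel borel \<phi> = lborel"
    unfolding \<phi>_def[abs_def] by (rule distr_lborel_transpose_join_xyz[OF A])
  have proj_\<phi>: "proj_xy (A *v \<phi> p) = fst p" for p
    by (simp add: \<phi>_def orthogonal_matrix_mult_cancel[OF A] del: transpose_matrix_vector)
  have "density lborel (\<lambda>x. ennreal (rho x)) = density (distr lborel borel \<phi>) (\<lambda>x. ennreal (rho x))"
    by (simp add: \<phi>)
  also have "\<dots> = distr (density lborel (\<lambda>p. ennreal (rho (\<phi> p)))) borel \<phi>"
    by (rule density_distr) auto
  finally have "distr (density lborel (\<lambda>x. ennreal (rho x))) borel (\<lambda>x. proj_xy (A *v x))
      = distr (density lborel (\<lambda>p. ennreal (rho (\<phi> p)))) borel fst"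
    by (simp add: distr_distr comp_def proj_\<phi>)
  also have "\<dots> = density lborel (\<lambda>w. \<integral>\<^sup>+z. ennreal (rho (\<phi> (w, z))) \<partial>lborel)"
    by (rule distr_fst_density_lborel) measurable
  also have "\<dots> = density lborel (\<lambda>w. ennreal (tomo_proj A rho w))"
  proof (rule density_cong)
    have tomo_proj_\<phi>: "tomo_proj A rho w = (\<integral>z. rho (\<phi> (w, z)) \<partial>lborel)" for w
      by (simp add: \<phi>_def tomo_proj_eq_integral_join_xyz del: transpose_matrix_vector)
    have "integrable lborel (\<lambda>p. rho (\<phi> p))"
      using int by (simp flip: \<phi> add: integrable_distr_eq)
    then have "AE w in lborel. integrable lborel (\<lambda>z. rho (\<phi> (w, z)))"
      using lborel_pair.AE_integrable_fst'[of "\<lambda>p. rho (\<phi> p)"] by (simp add: lborel_prod)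
    then show "AE w in lborel. (\<integral>\<^sup>+z. ennreal (rho (\<phi> (w, z))) \<partial>lborel) = ennreal (tomo_proj A rho w)"
      by eventually_elim (simp add: tomo_proj_\<phi> nn_integral_eq_integral nonneg)
    show "(\<lambda>w. ennreal (tomo_proj A rho w)) \<in> borel_measurable lborel"
      unfolding tomo_proj_\<phi> by measurable
  qed measurable
  finally show ?thesis
    by (simp add: dens_measure_def)
qed

lemma W1_distr_le_nn_integral:
  assumes "prob_space M" and [measurable]: "f \<in> borel_measurable M" "g \<in> borel_measurable M"
  shows "W1 (distr M borel f) (distr M borel g) \<le> (\<integral>\<^sup>+x. norm (f x - g x) \<partial>M)"
proof -
  have [measurable]: "(\<lambda>x. (f x, g x)) \<in> borel_measurable M"
    unfolding borel_prod[symmetric] by measurable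
  have [measurable]: "fst \<in> borel_measurable (borel :: ((real^2) \<times> (real^2)) measure)"
    "snd \<in> borel_measurable (borel :: ((real^2) \<times> (real^2)) measure)"
    unfolding borel_prod[symmetric] by simp_all
  define \<pi> where "\<pi> = distr M borel (\<lambda>x. (f x, g x))"
  have "prob_space \<pi>"
    unfolding \<pi>_def by (rule prob_space.prob_space_distr[OF assms(1)]) measurable
  then have "\<pi> \<in> couplings (distr M borel f) (distr M borel g)"
    by (simp add: couplings_def \<pi>_def distr_distr comp_def)
  then have "W1 (distr M borel f) (distr M borel g) \<le> (\<integral>\<^sup>+p. norm (fst p - snd p) \<partial>\<pi>)"
    unfolding W1_def by (rule INF_lower)
  also have "\<dots> = (\<integral>\<^sup>+x. norm (f x - g x) \<partial>M)"
    unfolding \<pi>_def by (simp add: nn_integral_distr)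
  finally show ?thesis .
qed

lemma W1_tomo_proj_le:
  fixes rho :: "real^3 \<Rightarrow> real" and A B :: "real^3^3"
  assumes A: "orthogonal_matrix A" and B: "orthogonal_matrix B"
    and [measurable]: "rho \<in> borel_measurable borel"
    and nonneg: "\<And>x. rho x \<ge> 0" and int: "integrable lborel rho"
    and total: "(LINT x|lborel. rho x) = 1"
    and close: "\<And>x. rho x \<noteq> 0 \<Longrightarrow> norm (A *v x - B *v x) \<le> c"
  shows "W1 (dens_measure (tomo_proj A rho)) (dens_measure (tomo_proj B rho)) \<le> ennreal c"
proof -
  define \<mu> where "\<mu> = density lborel (\<lambda>x. ennreal (rho x))"
  have mass: "(\<integral>\<^sup>+x. ennreal (rho x) \<partial>lborel) = 1"
    using nn_integral_eq_integral[OF int] nonneg total by simp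
  have "prob_space \<mu>"
    by standard (simp add: \<mu>_def emeasure_density mass)
  then have "W1 (dens_measure (tomo_proj A rho)) (dens_measure (tomo_proj B rho))
      \<le> (\<integral>\<^sup>+x. norm (proj_xy (A *v x) - proj_xy (B *v x)) \<partial>\<mu>)"
    using W1_distr_le_nn_integral[of \<mu> "\<lambda>x. proj_xy (A *v x)" "\<lambda>x. proj_xy (B *v x)"]
    by (simp add: \<mu>_def distr_density_proj_xy A B nonneg int)
  also have "\<dots> = (\<integral>\<^sup>+x. ennreal (rho x) * norm (proj_xy (A *v x - B *v x)) \<partial>lborel)"
    by (simp add: \<mu>_def nn_integral_density linear_diff[OF linear_proj_xy])
  also have "\<dots> \<le> (\<integral>\<^sup>+x. ennreal (rho x) * c \<partial>lborel)"
  proof (rule nn_integral_mono)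
    fix x
    show "ennreal (rho x) * norm (proj_xy (A *v x - B *v x)) \<le> ennreal (rho x) * c"
    proof (cases "rho x = 0")
      case False
      then have "norm (proj_xy (A *v x - B *v x)) \<le> c"
        using norm_proj_xy_le close order_trans by blast
      then show ?thesis
        by (intro mult_left_mono ennreal_leI) auto
    qed simp
  qed
  also have "\<dots> = ennreal c"
    by (simp add: nn_integral_multc mass)
  finally show ?thesis .
qed

lemma rotation_matrix_fixing_axis_3:
  fixes M :: "real^3^3"
  assumes rot: "rotation_matrix M" and fix3: "M *v axis 3 1 = axis 3 1"
  obtains g :: "real^2^2"
  where "rotation_matrix g" and "\<And>p. transpose M *v join_xyz p = join_xyz (transpose g *v fst p, snd p)"
proof -
  have om: "orthogonal_matrix M"
    using rot by (simp add: rotation_matrix_def)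
  have "transpose M *v axis 3 1 = axis 3 1"
    using orthogonal_matrix_mult_cancel(1)[OF om, of "axis 3 1"] fix3 by simp
  then have col3: "M$1$3 = 0" "M$2$3 = 0" "M$3$3 = 1" and row3: "M$3$1 = 0" "M$3$2 = 0"
    using fix3 by (simp_all add: matrix_vector_mult_def transpose_def sum_3 vec_eq_iff forall_3 axis_def)
  define g :: "real^2^2" where "g = vector [vector [M$1$1, M$1$2], vector [M$2$1, M$2$2]]"
  have cols: "(\<Sum>k\<in>UNIV. M$k$i * M$k$j) = (if i = j then 1 else 0)" for i j
  proof -
    have "(transpose M ** M) $ i $ j = mat 1 $ i $ j"
      using om by (simp add: orthogonal_matrix_def)
    then show ?thesis
      by (simp add: matrix_matrix_mult_def transpose_def mat_def)
  qed
  have rows: "(\<Sum>k\<in>UNIV. M$i$k * M$j$k) = (if i = j then 1 else 0)" for i j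
  proof -
    have "(M ** transpose M) $ i $ j = mat 1 $ i $ j"
      using om by (simp add: orthogonal_matrix_def)
    then show ?thesis
      by (simp add: matrix_matrix_mult_def transpose_def mat_def)
  qed
  have "orthogonal_matrix g"
    using cols[of 1 1] cols[of 1 2] cols[of 2 2] cols[of 2 1]
      rows[of 1 1] rows[of 1 2] rows[of 2 2] rows[of 2 1] col3 row3
    by (simp add: orthogonal_matrix_def g_def vec_eq_iff forall_2 matrix_matrix_mult_def
        transpose_def mat_def sum_2 sum_3 mult.commute)
  moreover have "det g = det M"
    using col3 row3 by (simp add: det_2 det_3 g_def)
  ultimately have "rotation_matrix g"
    using rot by (simp add: rotation_matrix_def)
  moreover have "transpose M *v join_xyz p = join_xyz (transpose g *v fst p, snd p)" for p
    using col3 row3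
    by (simp add: g_def join_xyz_def vec_eq_iff forall_3 matrix_vector_mult_def transpose_def sum_2 sum_3
        del: transpose_matrix_vector)
  ultimately show ?thesis
    by (rule that)
qed

lemma tomo_proj_same_direction:
  fixes A B :: "real^3^3"
  assumes A: "rotation_matrix A" and B: "rotation_matrix B"
    and "A *v w = vector [0, 0, -1]" and "B *v w = vector [0, 0, -1]"
  obtains g where "rotation_matrix g" and "tomo_proj A rho = rot2 g (tomo_proj B rho)"
proof -
  define M where "M = A ** transpose B"
  have B_orth: "orthogonal_matrix B"
    using B by (simp add: rotation_matrix_def)
  have "rotation_matrix M"
    unfolding M_def by (intro rotation_matrix_mul rotation_matrix_transpose A B)
  moreover have "M *v axis 3 1 = axis 3 1"
  proof -
    have "M *v (B *v w) = A *v w"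
      by (simp add: M_def orthogonal_matrix_mult_cancel[OF B_orth] flip: matrix_vector_mul_assoc
          del: transpose_matrix_vector)
    moreover have "axis 3 1 = - (vector [0, 0, -1] :: real^3)"
      by (simp add: vec_eq_iff forall_3 axis_def)
    ultimately show ?thesis
      using assms(3,4) by (simp add: linear_neg[OF matrix_vector_mul_linear])
  qed
  ultimately obtain g where g: "rotation_matrix g"
    and planar: "\<And>p. transpose M *v join_xyz p = join_xyz (transpose g *v fst p, snd p)"
    using rotation_matrix_fixing_axis_3 by blast
  have "M ** B = A"
    using B_orth by (simp add: M_def orthogonal_matrix_def flip: matrix_mul_assoc)
  then have "tomo_proj A rho = rot2 g (tomo_proj B rho)"
    by (auto simp: fun_eq_iff rot2_def tomo_proj_eq_integral_join_xyz matrix_transpose_mul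
        planar simp flip: matrix_vector_mul_assoc simp del: transpose_matrix_vector)
  with g show ?thesis
    by (rule that)
qed

section \<open>Rotations with small displacement\<close>

context includes cross3_syntax
begin

lemma rotation_matrix_of_cross_preserving:
  fixes f :: "real^3 \<Rightarrow> real^3"
  assumes lin: "linear f" and isometric: "\<And>x. norm (f x) = norm x"
    and cross: "f a \<times> f b = f (a \<times> b)" and nonzero: "a \<times> b \<noteq> 0"
  shows "rotation_matrix (matrix f)"
proof -
  have om: "orthogonal_matrix (matrix f)"
    using lin isometric orthogonal_transformation orthogonal_transformation_matrix by blast
  have "matrix f *v x = f x" for x
    using lin by (simp add: matrix_works)
  then have "f (a \<times> b) = det (matrix f) *\<^sub>R f (a \<times> b)"
    using cross_orthogonal_matrix[OF om, of a b] cross by simp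
  moreover have "f (a \<times> b) \<noteq> 0"
    using isometric[of "a \<times> b"] nonzero by auto
  ultimately have "det (matrix f) = 1"
    by (metis scaleR_cancel_right scaleR_one)
  with om show ?thesis
    by (simp add: rotation_matrix_def)
qed

lemma cross_cross_left: "(u \<times> v) \<times> w = (u \<bullet> w) *\<^sub>R v - (v \<bullet> w) *\<^sub>R u"
  by (simp add: cross3_simps forall_3)

lemma inner_cross_cross: "(x \<times> y) \<bullet> (x \<times> y) = (x \<bullet> x) * (y \<bullet> y) - (x \<bullet> y)\<^sup>2"
  by (simp add: cross3_simps power2_eq_square)

text \<open>Rodrigues' formula for the rotation about \<open>u \<times> v\<close> carrying the unit vector \<open>u\<close> to the
  unit vector \<open>v\<close>: the cosine of its angle is \<open>u \<bullet> v\<close> and the sine is the length of \<open>u \<times> v\<close>.\<close>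

definition rodrigues_rotation :: "real^3 \<Rightarrow> real^3 \<Rightarrow> real^3 \<Rightarrow> real^3" where
  "rodrigues_rotation u v x =
    (u \<bullet> v) *\<^sub>R x + (u \<times> v) \<times> x + (((u \<times> v) \<bullet> x) / (1 + u \<bullet> v)) *\<^sub>R (u \<times> v)"

lemma linear_rodrigues_rotation: "linear (rodrigues_rotation u v)"
  by (rule linearI) (simp_all add: rodrigues_rotation_def cross_add_right cross_mult_right
      inner_add_right add_divide_distrib algebra_simps)

lemma unit_inner_gt_minus_one:
  fixes u v :: "'a::real_inner"
  assumes "norm u = 1" "norm v = 1" "u \<noteq> - v"
  shows "1 + u \<bullet> v > 0"
proof -
  have "1 + u \<bullet> v = (norm (u + v))\<^sup>2 / 2"
    using dot_norm[of u v] assms(1,2) by (simp add: field_simps)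
  moreover have "(norm (u + v))\<^sup>2 > 0"
    using assms(3) by (simp add: add_eq_0_iff2)
  ultimately show ?thesis
    by (simp only: half_gt_zero_iff)
qed

lemma
  fixes u v x :: "real^3"
  assumes u: "norm u = 1" and v: "norm v = 1" and not_antipodal: "u \<noteq> - v"
  shows inner_rodrigues_rotation_self:
      "rodrigues_rotation u v x \<bullet> rodrigues_rotation u v x = x \<bullet> x"
    and inner_rodrigues_rotation:
      "x \<bullet> rodrigues_rotation u v x = (u \<bullet> v) * (x \<bullet> x) + ((u \<times> v) \<bullet> x)\<^sup>2 / (1 + u \<bullet> v)"
proof -
  define c where "c = u \<bullet> v"
  define k where "k = u \<times> v"
  have c: "1 + c > 0"
    unfolding c_def by (rule unit_inner_gt_minus_one[OF u v not_antipodal])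
  have kk: "k \<bullet> k = 1 - c\<^sup>2"
    using norm_cross_dot[of u v] u v by (simp add: k_def c_def power2_norm_eq_inner)
  have perp: "k \<bullet> (k \<times> x) = 0" "x \<bullet> (k \<times> x) = 0" "(k \<times> x) \<bullet> k = 0" "(k \<times> x) \<bullet> x = 0"
    by (simp_all add: dot_cross_self)
  have "rodrigues_rotation u v x \<bullet> rodrigues_rotation u v x
      = c\<^sup>2 * (x \<bullet> x) + ((k \<bullet> k) * (x \<bullet> x) - (k \<bullet> x)\<^sup>2) + ((k \<bullet> x) / (1 + c))\<^sup>2 * (k \<bullet> k)
        + 2 * c * ((k \<bullet> x) / (1 + c)) * (k \<bullet> x)"
    unfolding rodrigues_rotation_def c_def[symmetric] k_def[symmetric] inner_cross_cross[symmetric]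
    by (simp add: inner_add inner_commute perp power2_eq_square algebra_simps)
  also have "\<dots> = x \<bullet> x"
  proof -
    define d where "d = 1 + c"
    have c_eq: "c = d - 1" and "d \<noteq> 0"
      using c by (auto simp: d_def)
    then show ?thesis
      unfolding kk c_eq by (simp add: field_simps power2_eq_square)
  qed
  finally show "rodrigues_rotation u v x \<bullet> rodrigues_rotation u v x = x \<bullet> x" .
  show "x \<bullet> rodrigues_rotation u v x = (u \<bullet> v) * (x \<bullet> x) + ((u \<times> v) \<bullet> x)\<^sup>2 / (1 + u \<bullet> v)"
    unfolding rodrigues_rotation_def c_def[symmetric] k_def[symmetric]
    by (simp add: inner_add perp inner_commute[of x k] power2_eq_square)
qed

lemma
  fixes u v :: "real^3"
  assumes u: "norm u = 1" and v: "norm v = 1" and not_antipodal: "u \<noteq> - v"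
  shows rodrigues_rotation_source: "rodrigues_rotation u v u = v"
    and rodrigues_rotation_target: "rodrigues_rotation u v v = (2 * (u \<bullet> v)) *\<^sub>R v - u"
    and rodrigues_rotation_axis: "rodrigues_rotation u v (u \<times> v) = u \<times> v"
proof -
  have uu: "u \<bullet> u = 1" and vv: "v \<bullet> v = 1"
    using u v by (simp_all add: dot_square_norm)
  have c: "1 + u \<bullet> v > 0"
    by (rule unit_inner_gt_minus_one[OF u v not_antipodal])
  show "rodrigues_rotation u v u = v"
    by (simp add: rodrigues_rotation_def dot_cross_self cross_cross_left uu inner_commute)
  show "rodrigues_rotation u v v = (2 * (u \<bullet> v)) *\<^sub>R v - u"
    by (simp add: rodrigues_rotation_def dot_cross_self cross_cross_left vv scaleR_2
        flip: scaleR_scaleR)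
  have "u \<times> v \<bullet> (u \<times> v) = 1 - (u \<bullet> v)\<^sup>2"
    using norm_cross_dot[of u v] u v by (simp add: power2_norm_eq_inner)
  then have "u \<bullet> v + (u \<times> v \<bullet> (u \<times> v)) / (1 + u \<bullet> v) = 1"
    using c by (simp add: field_simps power2_eq_square)
  then show "rodrigues_rotation u v (u \<times> v) = u \<times> v"
    by (simp add: rodrigues_rotation_def scaleR_add_left[symmetric])
qed

lemma rotation_matrix_rodrigues_rotation:
  fixes u v :: "real^3"
  assumes u: "norm u = 1" and v: "norm v = 1" and "u \<noteq> v" "u \<noteq> - v"
  shows "rotation_matrix (matrix (rodrigues_rotation u v))"
proof -
  let ?f = "rodrigues_rotation u v" and ?c = "u \<bullet> v" and ?k = "u \<times> v"
  have uu: "u \<bullet> u = 1" and vv: "v \<bullet> v = 1"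
    using u v by (simp_all add: dot_square_norm)
  have "1 - ?c > 0"
    using unit_inner_gt_minus_one[of u "- v"] u v \<open>u \<noteq> v\<close> by simp
  moreover have "1 + ?c > 0"
    by (rule unit_inner_gt_minus_one[OF u v \<open>u \<noteq> - v\<close>])
  ultimately have "0 < (1 - ?c) * (1 + ?c)"
    by simp
  also have "(1 - ?c) * (1 + ?c) = (norm ?k)\<^sup>2"
    using norm_cross_dot[of u v] u v by (simp add: algebra_simps power2_eq_square)
  also have "(norm ?k)\<^sup>2 = (norm (u \<times> ?k))\<^sup>2"
    using norm_cross_dot[of u ?k] u by (simp add: dot_cross_self)
  finally have nonzero: "u \<times> ?k \<noteq> 0"
    by auto
  have uk: "u \<times> ?k = ?c *\<^sub>R u - v"
    by (subst cross_skew) (simp add: cross_cross_left uu inner_commute)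
  have vk: "v \<times> ?k = u - ?c *\<^sub>R v"
    by (subst cross_skew) (simp add: cross_cross_left vv inner_commute)
  have "?f u \<times> ?f ?k = u - ?c *\<^sub>R v"
    using u v \<open>u \<noteq> - v\<close> by (simp add: rodrigues_rotation_source rodrigues_rotation_axis vk)
  also have "\<dots> = ?f (u \<times> ?k)"
    using u v \<open>u \<noteq> - v\<close> unfolding uk
    by (simp add: linear_diff[OF linear_rodrigues_rotation] linear_cmul[OF linear_rodrigues_rotation]
        rodrigues_rotation_source rodrigues_rotation_target algebra_simps scaleR_2 flip: scaleR_scaleR)
  finally have cross: "?f u \<times> ?f ?k = ?f (u \<times> ?k)" .
  have "norm (?f x) = norm x" for x
    using inner_rodrigues_rotation_self[OF u v \<open>u \<noteq> - v\<close>] by (simp add: norm_eq_sqrt_inner)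
  then show ?thesis
    by (rule rotation_matrix_of_cross_preserving[OF linear_rodrigues_rotation _ cross nonzero])
qed

lemma norm_rodrigues_rotation_diff_le:
  fixes u v :: "real^3"
  assumes u: "norm u = 1" and v: "norm v = 1" and not_antipodal: "u \<noteq> - v"
  shows "norm (rodrigues_rotation u v x - x) \<le> norm (u - v) * norm x"
proof (rule power2_le_imp_le)
  have "(norm (u - v))\<^sup>2 = 2 - 2 * (u \<bullet> v)"
    using dot_norm_neg[of u v] u v by simp
  moreover have "x \<bullet> rodrigues_rotation u v x \<ge> (u \<bullet> v) * (x \<bullet> x)"
    using inner_rodrigues_rotation[OF assms, of x] unit_inner_gt_minus_one[OF assms] by simp
  ultimately show "(norm (rodrigues_rotation u v x - x))\<^sup>2 \<le> (norm (u - v) * norm x)\<^sup>2"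
    using inner_rodrigues_rotation_self[OF assms, of x]
    by (simp add: power2_norm_eq_inner power_mult_distrib inner_diff inner_commute algebra_simps)
qed simp

lemma half_turn_exists:
  fixes u :: "real^3"
  assumes u: "norm u = 1"
  obtains S where "rotation_matrix S" "S *v u = - u" "\<And>x. norm (S *v x - x) \<le> 2 * norm x"
proof -
  obtain y :: "real^3" where "y \<noteq> 0" "orthogonal u y"
    using orthogonal_to_vector_exists[of u] by auto
  define n where "n = y /\<^sub>R norm y"
  have nn: "n \<bullet> n = 1" and nu: "n \<bullet> u = 0"
    using \<open>y \<noteq> 0\<close> \<open>orthogonal u y\<close>
    by (simp_all add: n_def orthogonal_def inner_commute dot_square_norm)
  define f where "f x = (2 * (n \<bullet> x)) *\<^sub>R n - x" for x
  have lin: "linear f"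
    by (rule linearI) (simp_all add: f_def inner_add_right algebra_simps)
  have isometric: "norm (f x) = norm x" for x
    by (simp add: norm_eq_sqrt_inner f_def inner_diff inner_commute nn algebra_simps power2_eq_square)
  have fu: "f u = - u" and fn: "f n = n" and "f (u \<times> n) = - (u \<times> n)"
    using nu nn by (simp_all add: f_def inner_commute scaleR_2 dot_cross_self)
  then have "f u \<times> f n = f (u \<times> n)"
    by simp
  moreover have "u \<times> n \<noteq> 0"
    using norm_cross_dot[of u n] u nn nu by (auto simp: inner_commute dot_square_norm)
  ultimately have "rotation_matrix (matrix f)"
    by (rule rotation_matrix_of_cross_preserving[OF lin isometric])
  moreover have "norm (f x - x) \<le> 2 * norm x" for x
  proof -
    have "(norm (x - (n \<bullet> x) *\<^sub>R n))\<^sup>2 = x \<bullet> x - (n \<bullet> x)\<^sup>2"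
      by (simp only: power2_norm_eq_inner) (simp add: inner_diff inner_commute nn power2_eq_square)
    also have "\<dots> \<le> (norm x)\<^sup>2"
      by (simp add: power2_norm_eq_inner)
    finally have "(norm (x - (n \<bullet> x) *\<^sub>R n))\<^sup>2 \<le> (norm x)\<^sup>2" .
    then have "norm (x - (n \<bullet> x) *\<^sub>R n) \<le> norm x"
      by (rule power2_le_imp_le) simp
    moreover have "f x - x = - (2 *\<^sub>R (x - (n \<bullet> x) *\<^sub>R n))"
      by (simp add: f_def algebra_simps scaleR_2)
    ultimately show ?thesis
      by simp
  qed
  ultimately show ?thesis
    using that[of "matrix f"] fu lin by (simp add: matrix_works)
qed

lemma rotation_with_displacement_le:
  fixes u v :: "real^3"
  assumes u: "norm u = 1" and v: "norm v = 1"
  obtains S where "rotation_matrix S" "S *v u = v" "\<And>x. norm (S *v x - x) \<le> norm (u - v) * norm x"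
proof -
  consider "u = v" | "u = - v" | "u \<noteq> v" "u \<noteq> - v"
    by blast
  then show ?thesis
  proof cases
    case 1
    show ?thesis
      by (rule that[of "mat 1"]) (simp_all add: 1 rotation_matrix_def orthogonal_matrix_id det_I)
  next
    case 2
    have "u - v = - (2 *\<^sub>R v)"
      using 2 by (simp add: scaleR_2)
    then have "norm (u - v) = 2"
      using v by simp
    with 2 show ?thesis
      using half_turn_exists[OF u] that by (metis minus_minus)
  next
    case 3
    let ?f = "rodrigues_rotation u v"
    have "matrix ?f *v x = ?f x" for x
      using linear_rodrigues_rotation by (simp add: matrix_works)
    with 3 show ?thesis
      using that rotation_matrix_rodrigues_rotation[OF u v 3]
        rodrigues_rotation_source[OF u v 3(2)] norm_rodrigues_rotation_diff_le[OF u v 3(2)]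
      by simp
  qed
qed

end

section \<open>The angle between unit vectors\<close>

lemma vec_angle_nonneg: "0 \<le> vec_angle u v"
proof -
  have "\<bar>(u \<bullet> v) / (norm u * norm v)\<bar> \<le> 1"
  proof (cases "norm u * norm v = 0")
    case False
    then have pos: "0 < norm u * norm v"
      by (simp add: less_le)
    then have "\<bar>(u \<bullet> v) / (norm u * norm v)\<bar> = \<bar>u \<bullet> v\<bar> / (norm u * norm v)"
      by (simp add: abs_divide)
    also have "\<dots> \<le> 1"
      using pos Cauchy_Schwarz_ineq2[of u v] by (simp add: divide_le_eq_1_pos)
    finally show ?thesis .
  qed auto
  then have "-1 \<le> (u \<bullet> v) / (norm u * norm v)" "(u \<bullet> v) / (norm u * norm v) \<le> 1"
    by arith+
  then show ?thesis
    unfolding vec_angle_def by (rule arccos_lbound)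
qed

lemma norm_diff_eq_chord_vec_angle:
  fixes u v :: "real^3"
  assumes u: "norm u = 1" and v: "norm v = 1"
  shows "norm (u - v) = 2 * sin (vec_angle u v / 2)"
proof -
  have bounds: "-1 \<le> u \<bullet> v" "u \<bullet> v \<le> 1"
    using Cauchy_Schwarz_ineq2[of u v] u v by auto
  define \<theta> where "\<theta> = vec_angle u v"
  have \<theta>: "\<theta> = arccos (u \<bullet> v)"
    by (simp add: \<theta>_def vec_angle_def u v)
  have "0 \<le> \<theta>" "\<theta> \<le> pi"
    using arccos_lbound[OF bounds] arccos_ubound[OF bounds] by (simp_all add: \<theta>)
  then have "sin (\<theta> / 2) \<ge> 0"
    by (intro sin_ge_zero) auto
  moreover have "(norm (u - v))\<^sup>2 = (2 * sin (\<theta> / 2))\<^sup>2"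
  proof -
    have "(norm (u - v))\<^sup>2 = 2 - 2 * cos \<theta>"
      using dot_norm_neg[of u v] u v by (simp add: \<theta> cos_arccos[OF bounds])
    also have "\<dots> = (2 * sin (\<theta> / 2))\<^sup>2"
      using cos_double_sin[of "\<theta> / 2"] by (simp add: power_mult_distrib)
    finally show ?thesis .
  qed
  ultimately show ?thesis
    using power2_eq_iff_nonneg[of "norm (u - v)" "2 * sin (\<theta> / 2)"] by (simp add: \<theta>_def)
qed

theorem lemma2:
  fixes rho :: "real^3 \<Rightarrow> real" and u v :: "real^3" and R1 R2 :: "real^3^3"
  assumes "rho \<in> borel_measurable lborel"
    and "\<And>x. rho x \<ge> 0"
    and "integrable lborel rho"
    and "(LINT x|lborel. rho x) = 1"
    and "\<And>x. norm x > 1 \<Longrightarrow> rho x = 0"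
    and "norm u = 1" and "norm v = 1"
    and "rotation_matrix R1" and "R1 *v u = vector [0, 0, -1]"
    and "rotation_matrix R2" and "R2 *v v = vector [0, 0, -1]"
  shows "W1R (tomo_proj R1 rho) (tomo_proj R2 rho)
           \<le> ennreal (2 * sin (vec_angle u v / 2))
       \<and> 2 * sin (vec_angle u v / 2) \<le> vec_angle u v"
proof -
  obtain S where S: "rotation_matrix S" "S *v u = v"
    and displacement: "\<And>x. norm (S *v x - x) \<le> norm (u - v) * norm x"
    using rotation_with_displacement_le[OF assms(6,7)] by blast
  have R1_orth: "orthogonal_matrix R1" and S_orth: "orthogonal_matrix S"
    using assms(8) S(1) by (simp_all add: rotation_matrix_def)
  define R where "R = R1 ** transpose S"
  have R: "rotation_matrix R"
    unfolding R_def by (intro rotation_matrix_mul rotation_matrix_transpose assms(8) S(1))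
  have "R *v v = vector [0, 0, -1]"
    using assms(9) S(2) orthogonal_matrix_mult_cancel(1)[OF S_orth, of u]
    by (simp add: R_def flip: matrix_vector_mul_assoc del: transpose_matrix_vector)
  then obtain g where g: "rotation_matrix g" "tomo_proj R rho = rot2 g (tomo_proj R2 rho)"
    using tomo_proj_same_direction[OF R assms(10) _ assms(11)] by blast
  have close: "norm (R1 *v x - R *v x) \<le> norm (u - v)" if "rho x \<noteq> 0" for x
  proof -
    have "norm x \<le> 1"
      using assms(5)[of x] that by (meson not_le)
    then have "norm (S *v x - x) \<le> norm (u - v)"
      using displacement[of x] by (meson mult_left_le norm_ge_zero order_trans)
    then show ?thesis
      by (simp add: R_def norm_orthogonal_matrix_diff_mult_transpose R1_orth S_orth)
  qed
  have "W1R (tomo_proj R1 rho) (tomo_proj R2 rho)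
      \<le> W1 (dens_measure (tomo_proj R1 rho)) (dens_measure (rot2 g (tomo_proj R2 rho)))"
    unfolding W1R_def using g(1) by (intro INF_lower) simp
  also have "\<dots> \<le> ennreal (norm (u - v))"
    unfolding g(2)[symmetric] using assms(1-4)
    by (intro W1_tomo_proj_le R1_orth close) (auto simp: R[unfolded rotation_matrix_def])
  also have "\<dots> = ennreal (2 * sin (vec_angle u v / 2))"
    using norm_diff_eq_chord_vec_angle[OF assms(6,7)] by simp
  finally show ?thesis
    using sin_x_le_x[of "vec_angle u v / 2"] vec_angle_nonneg[of u v] by simp
qed

end
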